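(* Let $\mathit{nt}$ be the partial function defined on exactly those pairs $(\langle\chi,\vec a\rangle,\check\phi)$ (a loop and a quantifier-free formula over $\vec x$) for which \[ \check\phi(\vec x)\land\chi(\vec x)\implies\chi(\vec a(\vec x)) \] is valid, by $\mathit{nt}(\langle\chi,\vec a\rangle,\check\phi):=\chi$. Then $\mathit{nt}$ is a conditional non-termination technique; i.e., for every such pair and every $\vec x\in\mathbb Z^d$, if $\vec x$ is a witness of non-termination for $\langle\check\phi,\vec a\rangle$ and $\chi(\vec x)$ holds, then $\vec x$ is a witness of non-termination for $\langle\chi,\vec a\rangle$.
   Context: Fix $d\ge 1$ and integer variables $\vec x=(x_1,\dots,x_d)$. A loop $\langle\chi,\vec a\rangle$ consists of a quantifier-free formula $\chi$ over atoms $p>0$ ($p$ an arithmetic expression over $\vec x$, integer semantics) and a map $\vec a:\mathbb Z^d\to\mathbb Z^d$ given by expressions over $\vec x$; $\vec a^m$ is $m$-fold application ($\vec a^0=\mathrm{id}$). A vector $\vec x\in\mathbb Z^d$ is a witness of non-termination for $\langle\chi,\vec a\rangle$ if $\chi(\vec a^m(\vec x))$ holds for all $m\in\mathbb N$. A conditional non-termination technique is a partial function $\mathit{nt}$ mapping pairs (loop $\langle\chi,\vec a\rangle$, quantifier-free formula $\check\phi$ over $\vec x$) to quantifier-free formulas over $\vec x$ such that for all pairs in its domain and all $\vec x\in\mathbb Z^d$: if $\vec x$ is a witness of non-termination for $\langle\check\phi,\vec a\rangle$ and $\mathit{nt}(\langle\chi,\vec a\rangle,\check\phi)(\vec x)$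 holds, then $\vec x$ is a witness of non-termination for $\langle\chi,\vec a\rangle$. Validity means truth for all integer values of the free variables. *)

theory Defs
  imports "HOL-Analysis.Finite_Cartesian_Product"
begin

text \<open>
  The variables x_1, ..., x_d are the elements of a finite (hence nonempty) index type,
  so the dimension is its cardinality and valuations are integer vectors over that type.
  Division and exponentiation are made total on the integers by rounding the exact value down,
  with division by zero yielding zero.
\<close>

datatype 'd expr =
    Const int
  | Var 'd
  | Add "'d expr" "'d expr"
  | Sub "'d expr" "'d expr"
  | Mult "'d expr" "'d expr"
  | Div "'d expr" "'d expr"
  | Pow "'d expr" "'d expr"

primrec eval :: "'d::finite expr \<Rightarrow> int ^ 'd \<Rightarrow> int" where
  "eval (Const k) x = k"
| "eval (Var i) x = x $ i"
| "eval (Add p q) x = eval p x + eval q x"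
| "eval (Sub p q) x = eval p x - eval q x"
| "eval (Mult p q) x = eval p x * eval q x"
| "eval (Div p q) x = eval p x div eval q x"
| "eval (Pow p q) x =
    (if 0 \<le> eval q x then eval p x ^ nat (eval q x)
     else 1 div (eval p x ^ nat (- eval q x)))"

datatype 'd qf_formula =
    Pos "'d expr"  \<comment> \<open>the atom p > 0\<close>
  | Neg "'d qf_formula"
  | Conj "'d qf_formula" "'d qf_formula"
  | Disj "'d qf_formula" "'d qf_formula"

primrec sat :: "'d::finite qf_formula \<Rightarrow> int ^ 'd \<Rightarrow> bool" where
  "sat (Pos p) x \<longleftrightarrow> eval p x > 0"
| "sat (Neg \<phi>) x \<longleftrightarrow> \<not> sat \<phi> x"
| "sat (Conj \<phi> \<psi>) x \<longleftrightarrow> sat \<phi> x \<and> sat \<psi> x"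
| "sat (Disj \<phi> \<psi>) x \<longleftrightarrow> sat \<phi> x \<or> sat \<psi> x"

type_synonym 'd update = "'d \<Rightarrow> 'd expr"

type_synonym 'd loop = "'d qf_formula \<times> 'd update"

definition apply_update :: "'d::finite update \<Rightarrow> int ^ 'd \<Rightarrow> int ^ 'd" where
  "apply_update a x = (\<chi> i. eval (a i) x)"

definition nonterm_witness :: "'d::finite loop \<Rightarrow> int ^ 'd \<Rightarrow> bool" where
  "nonterm_witness L x \<longleftrightarrow> (\<forall>m. sat (fst L) ((apply_update (snd L) ^^ m) x))"

definition cond_nonterm_technique ::
    "('d::finite loop \<times> 'd qf_formula \<rightharpoonup> 'd qf_formula) \<Rightarrow> bool" where
  "cond_nonterm_technique nt \<longleftrightarrow>
    (\<forall>guard a \<phi> \<psi> x. nt ((guard, a), \<phi>) = Some \<psi> \<longrightarrow>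
      nonterm_witness (\<phi>, a) x \<longrightarrow> sat \<psi> x \<longrightarrow> nonterm_witness (guard, a) x)"

definition nt_increase :: "'d::finite loop \<times> 'd qf_formula \<rightharpoonup> 'd qf_formula" where
  "nt_increase = (\<lambda>((guard, a), \<phi>).
    if \<forall>x. sat \<phi> x \<and> sat guard x \<longrightarrow> sat guard (apply_update a x)
    then Some guard else None)"

end

theory Submission
  imports Defs
begin

text \<open>Induction along the orbit of \<open>x\<close>: a witness for \<open>\<phi>\<close>
  satisfies \<open>\<phi>\<close> at every iterate, so the implication \<open>step\<close>, used at
  the \<open>m\<close>-th iterate, carries \<open>guard\<close> to the next one.\<close>

lemma nonterm_witness_increase:
  assumes step: "\<And>y. sat \<phi> y \<Longrightarrow> sat guard y \<Longrightarrow> sat guard (apply_update a y)"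
    and "nonterm_witness (\<phi>, a) x" and "sat guard x"
  shows "nonterm_witness (guard, a) x"
proof -
  have "sat guard ((apply_update a ^^ m) x)" for m
    \<comment> \<open>\<open>^^\<close> unfolds with the new application outermost, so
      \<open>x\<close> stays fixed in the induction.\<close>
    by (induction m) (use assms in \<open>auto simp: nonterm_witness_def\<close>)
  then show ?thesis
    by (simp add: nonterm_witness_def)
qed

theorem theorem16:
  shows "cond_nonterm_technique
    (nt_increase :: 'd::finite loop \<times> 'd qf_formula \<rightharpoonup> 'd qf_formula)"
  unfolding cond_nonterm_technique_def nt_increase_def
  \<comment> \<open>A value \<open>Some \<psi>\<close> forces the first branch:
    \<open>\<psi>\<close> is \<open>guard\<close>, and the branch condition supplies
    \<open>step\<close>.\<close>
  by (auto split: if_splits intro: nonterm_witness_increase)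

end
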